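(* Let $A,B\subset\mathbb{R}^n$ be closed convex subsets and let $C=A+B$. If $C$ is a $P$-set, then there exist continuous functions $a:C\to A$ and $b:C\to B$ such that $a(c)+b(c)=c$ for all $c\in C$.
   Context: $A+B$ is the Minkowski sum. For a unit vector $q\in\mathbb{R}^n$ let $L(q)=\{z\in\mathbb{R}^n:\langle q,z\rangle=0\}$; each $z\in\mathbb{R}^n$ is written $z=x+\mu q=(x,\mu)$ with $x\in L(q)$, $\mu\in\mathbb{R}$, and $P_q z=x$ is the orthogonal projection onto $L(q)$. For a convex compact $A\subset\mathbb{R}^n$ define $f_{A,q}:P_qA\to\mathbb{R}$ by $f_{A,q}(x)=\min\{\mu : (x,\mu)\in A\}$. A convex compact set $A\subset\mathbb{R}^n$ is called a $P$-set if for every unit vector $q$ the function $f_{A,q}$ is continuous on $P_qA$. *)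

theory Defs
  imports "HOL-Analysis.Analysis"
begin

definition hyperplane_L :: "real ^ 'n \<Rightarrow> (real ^ 'n) set" where
  "hyperplane_L q = {z. q \<bullet> z = 0}"

text \<open>For a unit vector \<open>q\<close> this is the orthogonal projection onto \<open>hyperplane_L q\<close>;
  the next two lemmas record this and the decomposition \<open>z = x + \<mu> q\<close>.\<close>

definition proj_L :: "real ^ 'n \<Rightarrow> real ^ 'n \<Rightarrow> real ^ 'n" where
  "proj_L q z = z - (q \<bullet> z) *\<^sub>R q"

lemma proj_L_in_hyperplane:
  assumes "norm q = 1"
  shows "proj_L q z \<in> hyperplane_L q"
  using assms by (simp add: proj_L_def hyperplane_L_def inner_diff_right norm_eq_1)

lemma proj_L_unique:
  assumes "norm q = 1" and "x \<in> hyperplane_L q"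
  shows "z = x + \<mu> *\<^sub>R q \<longleftrightarrow> x = proj_L q z \<and> \<mu> = q \<bullet> z"
  using assms by (auto simp: proj_L_def hyperplane_L_def inner_add_right norm_eq_1)

text \<open>The minimum exists whenever \<open>A\<close> is compact and \<open>x \<in> proj_L q ` A\<close>;
  elsewhere the value is not used.\<close>

definition lower_fun :: "(real ^ 'n) set \<Rightarrow> real ^ 'n \<Rightarrow> real ^ 'n \<Rightarrow> real" where
  "lower_fun A q x = (LEAST \<mu>. x + \<mu> *\<^sub>R q \<in> A)"

lemma lower_fun_minimum:
  assumes "compact A" and "norm q = 1" and "x \<in> proj_L q ` A"
  shows "x + lower_fun A q x *\<^sub>R q \<in> A"
    and "x + \<mu> *\<^sub>R q \<in> A \<Longrightarrow> lower_fun A q x \<le> \<mu>"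
proof -
  have x: "x \<in> hyperplane_L q"
    using assms proj_L_in_hyperplane by auto
  let ?M = "{\<mu>. x + \<mu> *\<^sub>R q \<in> A}"
  have M: "?M = (\<lambda>z. q \<bullet> z) ` (A \<inter> {z. proj_L q z = x})"
    using proj_L_unique[OF assms(2) x] by (force simp: image_iff)
  have "closed {z. proj_L q z = x}"
    unfolding proj_L_def by (intro closed_Collect_eq continuous_intros)
  then have "compact ?M"
    unfolding M using assms(1)
    by (intro compact_continuous_image compact_Int_closed continuous_intros)
  moreover have "?M \<noteq> {}"
    unfolding M using assms(3) by auto
  ultimately obtain m where m: "m \<in> ?M" "\<And>t. t \<in> ?M \<Longrightarrow> m \<le> t"
    using compact_attains_inf[of ?M] by blast
  then have "lower_fun A q x = m"
    unfolding lower_fun_def by (intro Least_equality) auto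
  with m show "x + lower_fun A q x *\<^sub>R q \<in> A"
    and "x + \<mu> *\<^sub>R q \<in> A \<Longrightarrow> lower_fun A q x \<le> \<mu>"
    by auto
qed

definition P_set :: "(real ^ 'n) set \<Rightarrow> bool" where
  "P_set A \<longleftrightarrow> convex A \<and> compact A \<and>
     (\<forall>q. norm q = 1 \<longrightarrow> continuous_on (proj_L q ` A) (lower_fun A q))"

end

theory Submission
  imports Defs
begin

text \<open>
  For a direction \<open>q\<close>, call the set of points of \<open>S\<close> that cannot be moved inside \<open>S\<close> in
  direction \<open>q\<close> the upper boundary of \<open>S\<close>.  For compact \<open>S\<close> and unit \<open>q\<close> it is the graph
  of \<open>lower_fun S (- q)\<close>, so a \<open>P\<close>-set has closed upper boundaries in all directions
  (\<open>P_set_imp_closed_upper_boundary\<close>).  In this form the property is easy to use: to be movable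
  in direction \<open>q\<close> is then an open condition on the points of the set.

  The property passes from \<open>A + B\<close> to the summand \<open>A\<close> (\<open>closed_upper_boundary_summand\<close>).
  Those points \<open>x\<close> of the upper boundary of \<open>A\<close> that maximise over \<open>A\<close> a functional \<open>p\<close> with
  \<open>p \<bullet> q > 0\<close> are dense in it.  Adding to such an \<open>x\<close> a maximiser of \<open>p\<close> over \<open>B\<close> gives a
  maximiser of \<open>p\<close> over \<open>A + B\<close>, hence a point of the upper boundary of \<open>A + B\<close>.  Limits of
  these sums stay in that upper boundary, and if a sum \<open>a + b\<close> cannot be moved in \<open>A + B\<close> then
  \<open>a\<close> cannot be moved in \<open>A\<close>.

  Finally, let \<open>a c\<close> be the point of least norm of the fibre \<open>{x \<in> A. c - x \<in> B}\<close>, and suppose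
  that \<open>c\<^sub>n\<close> tends to \<open>c\<close> and \<open>a c\<^sub>n\<close> to \<open>x\<close>.  With \<open>q = a c - x\<close>, the point \<open>x\<close> can be moved in
  \<open>A\<close> in direction \<open>q\<close> and \<open>c - x\<close> can be moved in \<open>B\<close> in direction \<open>- q\<close>.  By openness the same
  is true of \<open>a c\<^sub>n\<close> and \<open>c\<^sub>n - a c\<^sub>n\<close> for large \<open>n\<close>, so the fibre over \<open>c\<^sub>n\<close> extends from
  \<open>a c\<^sub>n\<close> in direction \<open>q\<close>, and minimality of the norm gives \<open>a c\<^sub>n \<bullet> q \<ge> 0\<close>.  In the limit
  \<open>x \<bullet> (a c - x) \<ge> 0\<close>, which forces \<open>x = a c\<close>.  So \<open>a\<close> has a closed graph and compact range,
  and is therefore continuous (\<open>continuous_splitting\<close>).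
\<close>

section \<open>The upper boundary of a set in a direction\<close>

definition upper_boundary :: "'a::real_vector \<Rightarrow> 'a set \<Rightarrow> 'a set" where
  "upper_boundary q S = {x \<in> S. \<forall>t>0. x + t *\<^sub>R q \<notin> S}"

lemma upper_boundary_scaleR:
  assumes "r > 0"
  shows "upper_boundary (r *\<^sub>R q) S = upper_boundary q S"
proof -
  have "(\<forall>t>0. x + t *\<^sub>R r *\<^sub>R q \<notin> S) \<longleftrightarrow> (\<forall>t>0. x + t *\<^sub>R q \<notin> S)" for x
  proof
    assume *: "\<forall>t>0. x + t *\<^sub>R r *\<^sub>R q \<notin> S"
    show "\<forall>t>0. x + t *\<^sub>R q \<notin> S"
    proof (intro allI impI)
      fix t :: real assume "t > 0"
      then show "x + t *\<^sub>R q \<notin> S"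
        using *[rule_format, of "t / r"] assms by simp
    qed
  next
    assume *: "\<forall>t>0. x + t *\<^sub>R q \<notin> S"
    then show "\<forall>t>0. x + t *\<^sub>R r *\<^sub>R q \<notin> S"
      using assms by simp
  qed
  then show ?thesis
    unfolding upper_boundary_def by simp
qed

text \<open>If \<open>x\<close> can be moved by \<open>t q\<close>, convexity allows all shorter moves; hence two sets that
  both admit a move admit moves of a common length.\<close>

lemma not_upper_boundaryE:
  assumes "convex S" "x \<in> S" "x \<notin> upper_boundary q S"
  obtains t where "t > 0" "\<And>s. 0 \<le> s \<Longrightarrow> s \<le> t \<Longrightarrow> x + s *\<^sub>R q \<in> S"
proof -
  obtain t where t: "t > 0" "x + t *\<^sub>R q \<in> S"
    using assms unfolding upper_boundary_def by auto
  have "x + s *\<^sub>R q \<in> S" if s: "0 \<le> s" "s \<le> t" for s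
  proof -
    have "(1 - s / t) *\<^sub>R x + (s / t) *\<^sub>R (x + t *\<^sub>R q) \<in> S"
      using assms(1,2) t s by (intro convexD) auto
    moreover have "(1 - s / t) *\<^sub>R x + (s / t) *\<^sub>R (x + t *\<^sub>R q) = x + s *\<^sub>R q"
      using t(1) by (simp add: algebra_simps)
    ultimately show ?thesis by simp
  qed
  with t(1) show thesis by (rule that)
qed

lemma maximiser_in_upper_boundary:
  assumes "x \<in> S" "\<And>y. y \<in> S \<Longrightarrow> p \<bullet> y \<le> p \<bullet> x" "p \<bullet> q > 0"
  shows "x \<in> upper_boundary q S"
proof -
  have "x + t *\<^sub>R q \<notin> S" if "t > 0" for t
  proof
    assume "x + t *\<^sub>R q \<in> S"
    then have "t * (p \<bullet> q) \<le> 0"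
      using assms(2) by (fastforce simp: inner_add_right)
    moreover have "t * (p \<bullet> q) > 0"
      using that assms(3) by simp
    ultimately show False by simp
  qed
  with assms(1) show ?thesis
    unfolding upper_boundary_def by simp
qed

text \<open>Leaving \<open>S\<close> from \<open>a\<close> by a short step in direction \<open>q\<close> and projecting back onto \<open>S\<close> gives
  a point near \<open>a\<close>; the vector by which the projection moves is an outer normal there.\<close>

lemma upper_boundary_approx_maximiser:
  fixes S :: "'a::euclidean_space set"
  assumes "closed S" "convex S" "a \<in> upper_boundary q S" "e > 0"
  obtains x p where "x \<in> S" "dist x a < e" "p \<bullet> q > 0" "\<And>y. y \<in> S \<Longrightarrow> p \<bullet> y \<le> p \<bullet> x"
proof -
  have a: "a \<in> S" and out: "\<And>t. t > 0 \<Longrightarrow> a + t *\<^sub>R q \<notin> S"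
    using assms(3) unfolding upper_boundary_def by auto
  have q: "q \<noteq> 0"
    using a out[of 1] by auto
  \<comment> \<open>The projection is at most a step length away from \<open>a + t q\<close>, so at most twice that from \<open>a\<close>.\<close>
  define t where "t = e / (3 * norm q)"
  have t: "t > 0" "t * norm q = e / 3"
    using q assms(4) by (auto simp: t_def)
  define z where "z = a + t *\<^sub>R q"
  define x where "x = closest_point S z"
  define p where "p = z - x"
  have x: "x \<in> S"
    unfolding x_def using assms(1) a by (intro closest_point_in_set) auto
  have normal: "p \<bullet> (y - x) \<le> 0" if "y \<in> S" for y
    unfolding p_def x_def using closest_point_dot[OF assms(2,1) that] .
  have "dist z x \<le> dist z a"
    unfolding x_def using closest_point_le[OF assms(1) a] .
  moreover have "dist z a = e / 3"
    unfolding z_def using t by (simp add: dist_norm)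
  ultimately have "dist x a < e"
    using dist_triangle[of x a z] assms(4) by (simp add: dist_commute)
  moreover have "p \<bullet> q > 0"
  proof -
    have "p \<noteq> 0"
      using x out[OF t(1)] unfolding p_def z_def by auto
    then have "p \<bullet> p > 0" by simp
    \<comment> \<open>As \<open>a - x = p - t q\<close>, the inequality for the normal \<open>p\<close> says \<open>p \<bullet> p \<le> t (p \<bullet> q)\<close>.\<close>
    moreover have "a - x = p - t *\<^sub>R q"
      unfolding p_def z_def by simp
    then have "p \<bullet> (a - x) = p \<bullet> p - t * (p \<bullet> q)"
      by (simp add: inner_diff_right)
    ultimately have "t * (p \<bullet> q) > 0"
      using normal[OF a] by linarith
    then show ?thesis
      using t(1) by (simp add: zero_less_mult_iff)
  qed
  moreover have "p \<bullet> y \<le> p \<bullet> x" if "y \<in> S" for y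
    using normal[OF that] by (simp add: inner_diff_right)
  ultimately show thesis
    using that x by blast
qed

section \<open>Summands of a set with closed upper boundary\<close>

lemma closed_upper_boundary_summand:
  fixes A B :: "'a::euclidean_space set"
  assumes "closed A" "convex A" "compact B" "B \<noteq> {}"
    and sum: "closed (upper_boundary q (A + B))"
  shows "closed (upper_boundary q A)"
  unfolding closed_sequential_limits
proof (intro allI impI, elim conjE)
  fix u a assume u: "\<forall>n. u n \<in> upper_boundary q A" and lim: "u \<longlonglongrightarrow> a"
  have "\<exists>x b. x \<in> A \<and> b \<in> B \<and> dist x (u n) < 1 / Suc n \<and> x + b \<in> upper_boundary q (A + B)" for n
  proof -
    obtain x p where x: "x \<in> A" "dist x (u n) < 1 / Suc n" "p \<bullet> q > 0"
        "\<And>y. y \<in> A \<Longrightarrow> p \<bullet> y \<le> p \<bullet> x"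
      using upper_boundary_approx_maximiser[OF assms(1,2) u[rule_format, of n], of "1 / Suc n"]
      by auto
    obtain b where b: "b \<in> B" "\<And>y. y \<in> B \<Longrightarrow> p \<bullet> y \<le> p \<bullet> b"
      using continuous_attains_sup[OF assms(3,4) continuous_on_inner[OF continuous_on_const
        continuous_on_id], of p] by blast
    have "x + b \<in> upper_boundary q (A + B)"
    proof (rule maximiser_in_upper_boundary)
      show "x + b \<in> A + B" using x(1) b(1) by (rule set_plus_intro)
      show "p \<bullet> y \<le> p \<bullet> (x + b)" if "y \<in> A + B" for y
        using that
      proof (rule set_plus_elim)
        fix y1 y2 assume "y = y1 + y2" "y1 \<in> A" "y2 \<in> B"
        with x(4)[of y1] b(2)[of y2] show ?thesis by (simp add: inner_add_right)
      qed
    qed (fact x(3))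
    with x b show ?thesis by blast
  qed
  then obtain x b where x: "\<And>n. x n \<in> A" "\<And>n. dist (x n) (u n) < 1 / Suc n"
      and b: "\<And>n. b n \<in> B" and xb: "\<And>n. x n + b n \<in> upper_boundary q (A + B)"
    by metis
  have "(\<lambda>n. dist (x n) (u n)) \<longlonglongrightarrow> 0"
    by (rule tendsto_sandwich[OF _ _ tendsto_const LIMSEQ_inverse_real_of_nat])
       (auto intro!: always_eventually less_imp_le[OF x(2)] simp: inverse_eq_divide simp del: of_nat_Suc)
  then have "(\<lambda>n. x n - u n) \<longlonglongrightarrow> 0"
    by (simp add: dist_norm tendsto_norm_zero_iff)
  from tendsto_add[OF this lim] have xlim: "x \<longlonglongrightarrow> a" by simp
  obtain l r where l: "l \<in> B" "strict_mono r" "(b \<circ> r) \<longlonglongrightarrow> l"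
    using assms(3) b unfolding compact_def by meson
  have "(\<lambda>n. (x \<circ> r) n + (b \<circ> r) n) \<longlonglongrightarrow> a + l"
    using LIMSEQ_subseq_LIMSEQ[OF xlim l(2)] l(3) by (rule tendsto_add)
  then have al: "a + l \<in> upper_boundary q (A + B)"
    by (rule closed_sequentially[OF sum, rotated]) (simp add: xb)
  have "a \<in> A"
    using closed_sequentially[OF assms(1) _ xlim] x(1) by blast
  moreover have "a + t *\<^sub>R q \<notin> A" if "t > 0" for t
  proof
    assume "a + t *\<^sub>R q \<in> A"
    then have "(a + t *\<^sub>R q) + l \<in> A + B"
      using l(1) by (rule set_plus_intro)
    with al that show False
      unfolding upper_boundary_def by (simp add: add_ac)
  qed
  ultimately show "a \<in> upper_boundary q A"
    unfolding upper_boundary_def by simp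
qed

section \<open>Continuous splitting\<close>

text \<open>A point at which the norm does not decrease to first order towards the least-norm point
  \<open>m\<close> has norm at most \<open>norm m\<close>, and the least-norm point of a convex set is unique.\<close>

lemma eq_least_norm_point:
  fixes S :: "'a::euclidean_space set"
  assumes "convex S" "closed S" "x \<in> S" and ge: "x \<bullet> (closest_point S 0 - x) \<ge> 0"
  shows "x = closest_point S 0"
proof -
  let ?m = "closest_point S 0"
  have "(0 - ?m) \<bullet> (x - ?m) \<le> 0"
    using assms(1-3) by (rule closest_point_dot)
  with ge have "(x - ?m) \<bullet> (x - ?m) \<le> 0"
    by (simp add: inner_diff_left inner_diff_right inner_commute)
  then show ?thesis
    by (simp add: inner_gt_zero_iff flip: not_less)
qed

theorem continuous_splitting:
  fixes A B :: "'a::euclidean_space set"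
  assumes A: "compact A" "convex A" "\<And>q. closed (upper_boundary q A)"
    and B: "compact B" "convex B" "\<And>q. closed (upper_boundary q B)"
  shows "\<exists>a. continuous_on (A + B) a \<and> (\<forall>c\<in>A + B. a c \<in> A \<and> c - a c \<in> B)"
proof -
  define F where "F c = A \<inter> (\<lambda>x. c - x) -` B" for c
  define a where "a c = closest_point (F c) 0" for c
  have clA: "closed A" and clB: "closed B"
    using A(1) B(1) by (auto intro: compact_imp_closed)
  have clF: "closed (F c)" for c
    unfolding F_def by (intro closed_Int clA closed_vimage clB continuous_intros)
  have cvF: "convex (F c)" for c
  proof -
    have "(\<lambda>x. c - x) -` B = (+) c ` uminus ` B"
      by (force simp: image_iff)
    then show ?thesis
      unfolding F_def using A(2) B(2)
      by (simp only:) (intro convex_Int convex_translation convex_negations)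
  qed
  have aF: "a c \<in> F c" if "c \<in> A + B" for c
  proof -
    from that obtain x y where "x \<in> A" "y \<in> B" "c = x + y" by (rule set_plus_elim)
    then have "x \<in> F c" unfolding F_def by simp
    then show ?thesis
      unfolding a_def using clF by (intro closest_point_in_set) auto
  qed
  have "continuous_on (A + B) a"
  proof (rule continuous_from_closed_graph[OF A(1)])
    show "a \<in> A + B \<rightarrow> A"
      using aF unfolding F_def by auto
    show "closed ((\<lambda>c. (c, a c)) ` (A + B))"
      unfolding closed_sequential_limits
    proof (intro allI impI, elim conjE)
      fix w l assume w: "\<forall>n. w n \<in> (\<lambda>c. (c, a c)) ` (A + B)" and lim: "w \<longlonglongrightarrow> l"
      obtain c x where l: "l = (c, x)" by fastforce
      define u where "u n = fst (w n)" for n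
      have u: "u n \<in> A + B" and w_eq: "w n = (u n, a (u n))" for n
        using w[rule_format, of n] by (auto simp: u_def)
      have ulim: "u \<longlonglongrightarrow> c"
        using tendsto_fst[OF lim] by (simp add: l w_eq)
      have alim: "(\<lambda>n. a (u n)) \<longlonglongrightarrow> x"
        using tendsto_snd[OF lim] by (simp add: l w_eq)
      have blim: "(\<lambda>n. u n - a (u n)) \<longlonglongrightarrow> c - x"
        using ulim alim by (rule tendsto_diff)
      have auA: "a (u n) \<in> A" and auB: "u n - a (u n) \<in> B" for n
        using aF[OF u[of n]] unfolding F_def by auto
      have xA: "x \<in> A" using closed_sequentially[OF clA _ alim] auA by blast
      have xB: "c - x \<in> B" using closed_sequentially[OF clB _ blim] auB by blast
      have c: "c \<in> A + B"
        using set_plus_intro[OF xA xB] by simp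
      define q where "q = a c - x"
      have acA: "x + 1 *\<^sub>R q \<in> A" and acB: "(c - x) + 1 *\<^sub>R (- q) \<in> B"
        using aF[OF c] unfolding F_def q_def by auto
      have "x \<in> - upper_boundary q A"
        using acA unfolding upper_boundary_def by (auto intro!: exI[of _ 1])
      then have evA: "eventually (\<lambda>n. a (u n) \<in> - upper_boundary q A) sequentially"
        by (intro topological_tendstoD[OF alim] open_Compl A(3))
      have "c - x \<in> - upper_boundary (- q) B"
        using acB unfolding upper_boundary_def by (auto intro!: exI[of _ 1])
      then have evB: "eventually (\<lambda>n. u n - a (u n) \<in> - upper_boundary (- q) B) sequentially"
        by (intro topological_tendstoD[OF blim] open_Compl B(3))
      from evA evB have "eventually (\<lambda>n. a (u n) \<bullet> q \<ge> 0) sequentially"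
      proof eventually_elim
        case (elim n)
        obtain s where s: "s > 0" "\<And>r. 0 \<le> r \<Longrightarrow> r \<le> s \<Longrightarrow> a (u n) + r *\<^sub>R q \<in> A"
          using not_upper_boundaryE[OF A(2) auA[of n]] elim(1) by (metis ComplD)
        obtain t where t: "t > 0"
            "\<And>r. 0 \<le> r \<Longrightarrow> r \<le> t \<Longrightarrow> (u n - a (u n)) + r *\<^sub>R (- q) \<in> B"
          using not_upper_boundaryE[OF B(2) auB[of n]] elim(2) by (metis ComplD)
        have pos: "min s t > 0" using s(1) t(1) by simp
        have "a (u n) + min s t *\<^sub>R q \<in> F (u n)"
          using s(2)[of "min s t"] t(2)[of "min s t"] pos
          unfolding F_def by (simp add: algebra_simps)
        from closest_point_dot[OF cvF clF this, of 0]
        have "0 \<le> min s t * (a (u n) \<bullet> q)"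
          unfolding a_def[symmetric] by simp
        with pos show ?case
          by (metis zero_le_mult_iff not_less)
      qed
      then have "x \<bullet> q \<ge> 0"
        by (intro tendsto_lowerbound[OF tendsto_inner[OF alim tendsto_const]]) auto
      then have "x = a c"
        unfolding a_def q_def using xA xB
        by (intro eq_least_norm_point cvF clF) (auto simp: F_def)
      with c show "l \<in> (\<lambda>c. (c, a c)) ` (A + B)"
        unfolding l by blast
    qed
  qed
  moreover have "\<forall>c\<in>A + B. a c \<in> A \<and> c - a c \<in> B"
    using aF unfolding F_def by auto
  ultimately show ?thesis by blast
qed

section \<open>Upper boundaries of \<open>P\<close>-sets\<close>

lemma upper_boundary_eq_lower_graph:
  assumes "compact C" "norm v = 1"
  shows "upper_boundary (- v) C = {x \<in> C. lower_fun C v (proj_L v x) - v \<bullet> x = 0}"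
proof -
  have "(\<forall>t>0. x + t *\<^sub>R (- v) \<notin> C) \<longleftrightarrow> lower_fun C v (proj_L v x) - v \<bullet> x = 0"
    if x: "x \<in> C" for x
  proof -
    let ?f = "lower_fun C v (proj_L v x)"
    have px: "proj_L v x \<in> proj_L v ` C" using x by simp
    have line: "x + t *\<^sub>R (- v) = proj_L v x + (v \<bullet> x - t) *\<^sub>R v" for t
      unfolding proj_L_def by (simp add: algebra_simps)
    have le: "?f \<le> v \<bullet> x - t" if "x + t *\<^sub>R (- v) \<in> C" for t
      using lower_fun_minimum(2)[OF assms px] that unfolding line by simp
    have "x + (v \<bullet> x - ?f) *\<^sub>R (- v) \<in> C"
      using lower_fun_minimum(1)[OF assms px] unfolding line by simp
    then show ?thesis
      using le[of 0] x le by (smt (verit) scaleR_zero_left add_0_right)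
  qed
  then show ?thesis
    unfolding upper_boundary_def by blast
qed

lemma P_set_imp_closed_upper_boundary:
  assumes "P_set C"
  shows "closed (upper_boundary q C)"
proof (cases "q = 0")
  case True
  then have "upper_boundary q C = {}"
    unfolding upper_boundary_def by (auto intro!: exI[of _ 1])
  then show ?thesis by simp
next
  case False
  define v where "v = - (q /\<^sub>R norm q)"
  have v: "norm v = 1" and q: "q = norm q *\<^sub>R (- v)"
    using False by (auto simp: v_def)
  have C: "compact C" and cont: "continuous_on (proj_L v ` C) (lower_fun C v)"
    using assms v unfolding P_set_def by auto
  have "continuous_on C (proj_L v)"
    unfolding proj_L_def by (intro continuous_intros)
  from continuous_on_compose[OF this cont]
  have "continuous_on C (\<lambda>x. lower_fun C v (proj_L v x))"
    by (simp add: o_def)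
  then have "closed {x \<in> C. lower_fun C v (proj_L v x) - v \<bullet> x = 0}"
    using C by (intro continuous_closed_preimage_constant continuous_intros compact_imp_closed)
  then have "closed (upper_boundary (- v) C)"
    by (simp add: upper_boundary_eq_lower_graph[OF C v])
  then show ?thesis
    using upper_boundary_scaleR[of "norm q" "- v" C] False q by simp
qed

lemma compact_summand:
  fixes A B :: "'a::euclidean_space set"
  assumes "closed A" "bounded (A + B)" "B \<noteq> {}"
  shows "compact A"
proof -
  obtain b where b: "b \<in> B" using assms(3) by blast
  have "(\<lambda>x. b + x) ` A \<subseteq> A + B"
    using b by (auto intro: set_plus_intro simp: add.commute[of b])
  then have "bounded ((\<lambda>x. b + x) ` A)"
    using assms(2) by (rule bounded_subset[rotated])
  then have "bounded ((\<lambda>x. - b + x) ` (\<lambda>x. b + x) ` A)"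
    by (rule bounded_translation)
  then show ?thesis
    using assms(1) by (simp add: image_image compact_eq_bounded_closed)
qed

theorem theorem2p6:
  fixes A B C :: "(real ^ 'n) set"
  assumes "closed A" and "convex A"
    and "closed B" and "convex B"
    and "C = A + B"
    and "P_set C"
  shows "\<exists>a b. continuous_on C a \<and> a ` C \<subseteq> A \<and>
               continuous_on C b \<and> b ` C \<subseteq> B \<and>
               (\<forall>c\<in>C. a c + b c = c)"
proof (cases "C = {}")
  case True
  then show ?thesis by simp
next
  case False
  then have ne: "A \<noteq> {}" "B \<noteq> {}"
    using assms(5) by (auto simp: set_plus_def)
  have "bounded (A + B)"
    using assms(5,6) unfolding P_set_def by (auto intro: compact_imp_bounded)
  then have A: "compact A" and B: "compact B"
    using compact_summand[of A B] compact_summand[of B A] assms ne by (auto simp: add.commute)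
  have ub: "closed (upper_boundary q (A + B))" for q
    using P_set_imp_closed_upper_boundary assms(5,6) by blast
  have "closed (upper_boundary q A)" for q
    using closed_upper_boundary_summand[OF assms(1,2) B ne(2) ub] .
  moreover have "closed (upper_boundary q B)" for q
    using closed_upper_boundary_summand[OF assms(3,4) A ne(1)] ub by (simp add: add.commute)
  ultimately obtain a where a: "continuous_on C a" "\<forall>c\<in>C. a c \<in> A \<and> c - a c \<in> B"
    using continuous_splitting[OF A assms(2) _ B assms(4)] unfolding assms(5) by blast
  have "continuous_on C (\<lambda>c. c - a c)"
    using a(1) by (intro continuous_intros)
  with a show ?thesis
    by (intro exI[of _ a] exI[of _ "\<lambda>c. c - a c"]) auto
qed

end
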